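(* Let $G^\sigma$ be an oriented hypergraph whose underlying hypergraph $G$ is connected and $k$-uniform with $k$ even. Then the following are equivalent: (1) $\Gamma G^\sigma$ is switching equivalent to $\Gamma G^+$; (2) $S\,\mathcal{A}(\Gamma G^\sigma)\,S=-\mathcal{A}(G)$ for some signature matrix $S$; (3) $-\rho(\mathcal{A}(G))$ is an H-eigenvalue of $\mathcal{A}(\Gamma G^\sigma)$; (4) $S\,\mathcal{L}(\Gamma G^\sigma)\,S=\mathcal{L}(G)$ for some signature matrix $S$; (5) $0$ is an H-eigenvalue of $\mathcal{L}(\Gamma G^\sigma)$; (6) there is a bipartition $\{V^+,V^-\}$ of $V(G)$ such that each positive edge of $\Gamma G^\sigma$ intersects $V^-$ in an odd number of vertices and each negative edge intersects $V^-$ in an even number of vertices.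
   Context: A $k$-uniform hypergraph $G$ has vertex set $V(G)=[n]$ and edge set $E(G)$ of $k$-element subsets; it is connected if any two elements of $V(G)\cup E(G)$ are joined by an alternating vertex–edge sequence with consecutive elements incident. The degree $d_i$ of vertex $i$ is the number of edges containing it. An oriented hypergraph $G^\sigma$ is $G$ with a map $\sigma$ assigning $\pm1$ to each pair $(e,v)$ with $v\in e$; $G^+$ has $\sigma\equiv1$. The induced signed hypergraph $\Gamma G^\sigma$ is $G$ with edge signs $\gamma(e)=(-1)^{|e|-1}\prod_{v\in e}\sigma(e,v)$; an edge is positive if $\gamma(e)=1$ and negative if $\gamma(e)=-1$. A vertex switching at $v$ on a signed hypergraph negates the sign of every edge containing $v$; switching equivalence means related by a finite sequence of vertex switchings. The adjacency tensor $\mathcal{A}(\Gamma)$ of a signed hypergraph $(G,\gamma)$ is the order-$k$, dimension-$n$ tensor with entry $\gamma(e)/(k-1)!$ at $(i_1,\dots,i_k)$ if $\{i_1,\dots,i_k\}=e\in E(G)$ and $0$ otherwise; $\mathcal{A}(G)$ is the same with all $\gamma(e)=1$. $\mathcal{D}(G)$ is the order-$k$ diagonal tensor with $(i,\dots,i)$ entry $d_i$; $\mathcal{L}(\Gamma)=\mathcal{D}(G)+\mathcal{A}(\Gamma)$ and $\mathcal{L}(G)=\mathcal{D}(G)-\mathcal{A}(G)$. A signature matrix is a diagonal matrix with entries in $\{1,-1\}$; for diagonal $P=\mathrm{diag}(p_i)$, $Q=\mathrm{diag}(q_i)$, $(P\mathcal{A}Q)_{i_1\dots i_k}=p_{i_1}a_{i_1\dots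 i_k}q_{i_2}\cdots q_{i_k}$. For $x\in\mathbb{C}^n$, $(\mathcal{A}x^{k-1})_i=\sum_{i_2,\dots,i_k}a_{ii_2\dots i_k}x_{i_2}\cdots x_{i_k}$; $\lambda$ is an eigenvalue if $\mathcal{A}x^{k-1}=\lambda x^{[k-1]}$ for some nonzero $x\in\mathbb{C}^n$ with $x^{[k-1]}=(x_i^{k-1})_i$, and an H-eigenvalue if such $x$ can be chosen real; $\rho(\mathcal{A})$ is the maximum modulus of the eigenvalues. A bipartition $\{V^+,V^-\}$ means $V^+\cup V^-=V(G)$, $V^+\cap V^-=\emptyset$, with one part possibly empty. *)

theory Defs
  imports "HOL-Analysis.Analysis"
begin

text \<open>
  The vertex set \<open>[n]\<close> is the finite type \<^typ>\<open>'n\<close>, so that \<open>n = CARD('n) \<ge> 1\<close> and vectors in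
  \<open>\<complex>\<^sup>n\<close> have type \<^typ>\<open>complex ^ 'n\<close>. A hypergraph is given by its set of edges
  \<open>E :: 'n set set\<close>.
\<close>

definition uniform_hypergraph :: "nat \<Rightarrow> 'n set set \<Rightarrow> bool" where
  "uniform_hypergraph k E \<longleftrightarrow> (\<forall>e\<in>E. finite e \<and> card e = k)"

definition incidence :: "'n set set \<Rightarrow> ('n + 'n set) rel" where
  "incidence E = {(Inl v, Inr e) | v e. e \<in> E \<and> v \<in> e} \<union> {(Inr e, Inl v) | v e. e \<in> E \<and> v \<in> e}"

definition connected_hypergraph :: "'n set set \<Rightarrow> bool" where
  "connected_hypergraph E \<longleftrightarrow>
     (\<forall>a \<in> UNIV <+> E. \<forall>b \<in> UNIV <+> E. (a, b) \<in> (incidence E)\<^sup>*)"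

definition vertex_degree :: "'n set set \<Rightarrow> 'n \<Rightarrow> nat" where
  "vertex_degree E v = card {e \<in> E. v \<in> e}"

text \<open>
  Orientations \<open>\<sigma> e v\<close> and edge signs \<open>\<gamma> e\<close> are total functions; only their values at incident
  pairs, respectively at edges, are meaningful.
\<close>

definition orientation :: "'n set set \<Rightarrow> ('n set \<Rightarrow> 'n \<Rightarrow> int) \<Rightarrow> bool" where
  "orientation E \<sigma> \<longleftrightarrow> (\<forall>e\<in>E. \<forall>v\<in>e. \<sigma> e v \<in> {1, -1})"

definition induced_sign :: "('n set \<Rightarrow> 'n \<Rightarrow> int) \<Rightarrow> 'n set \<Rightarrow> int" where
  "induced_sign \<sigma> e = (-1) ^ (card e - 1) * (\<Prod>v\<in>e. \<sigma> e v)"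

definition vertex_switch :: "'n \<Rightarrow> ('n set \<Rightarrow> int) \<Rightarrow> 'n set \<Rightarrow> int" where
  "vertex_switch v \<gamma> e = (if v \<in> e then - \<gamma> e else \<gamma> e)"

definition switching_equivalent :: "'n set set \<Rightarrow> ('n set \<Rightarrow> int) \<Rightarrow> ('n set \<Rightarrow> int) \<Rightarrow> bool" where
  "switching_equivalent E \<gamma> \<gamma>' \<longleftrightarrow> (\<exists>vs. \<forall>e\<in>E. fold vertex_switch vs \<gamma> e = \<gamma>' e)"

text \<open>
  The entry \<open>a\<^bsub>i\<^sub>1 \<dots> i\<^sub>k\<^esub>\<close> of a tensor is its value at the list \<open>[i\<^sub>1, \<dots>, i\<^sub>k]\<close>. The concrete tensors
  of order \<open>k\<close> below vanish on lists of any other length (when \<open>k \<ge> 1\<close>), so equality of tensors is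
  equality of functions.
\<close>

type_synonym 'n tensor = "'n list \<Rightarrow> complex"

definition adjacency_tensor :: "nat \<Rightarrow> 'n set set \<Rightarrow> ('n set \<Rightarrow> int) \<Rightarrow> 'n tensor" where
  "adjacency_tensor k E \<gamma> is =
     (if length is = k \<and> set is \<in> E then of_int (\<gamma> (set is)) / fact (k - 1) else 0)"

definition hypergraph_adjacency_tensor :: "nat \<Rightarrow> 'n set set \<Rightarrow> 'n tensor" where
  "hypergraph_adjacency_tensor k E = adjacency_tensor k E (\<lambda>_. 1)"

definition degree_tensor :: "nat \<Rightarrow> 'n set set \<Rightarrow> 'n tensor" where
  "degree_tensor k E is = (if is = replicate k (hd is) then of_nat (vertex_degree E (hd is)) else 0)"

definition laplacian_tensor :: "nat \<Rightarrow> 'n set set \<Rightarrow> ('n set \<Rightarrow> int) \<Rightarrow> 'n tensor" where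
  "laplacian_tensor k E \<gamma> is = degree_tensor k E is + adjacency_tensor k E \<gamma> is"

definition hypergraph_laplacian_tensor :: "nat \<Rightarrow> 'n set set \<Rightarrow> 'n tensor" where
  "hypergraph_laplacian_tensor k E is = degree_tensor k E is - hypergraph_adjacency_tensor k E is"

definition signature_matrix :: "complex ^ 'n ^ 'n \<Rightarrow> bool" where
  "signature_matrix S \<longleftrightarrow> (\<forall>i j. i \<noteq> j \<longrightarrow> S $ i $ j = 0) \<and> (\<forall>i. S $ i $ i \<in> {1, -1})"

text \<open>The product \<open>P A Q\<close>, meant for diagonal matrices \<open>P\<close> and \<open>Q\<close> only.\<close>

definition diag_tensor_mult :: "complex ^ 'n ^ 'n \<Rightarrow> 'n tensor \<Rightarrow> complex ^ 'n ^ 'n \<Rightarrow> 'n tensor" where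
  "diag_tensor_mult P A Q is = P $ hd is $ hd is * A is * (\<Prod>i\<leftarrow>tl is. Q $ i $ i)"

definition tensor_apply :: "nat \<Rightarrow> 'n::finite tensor \<Rightarrow> complex ^ 'n \<Rightarrow> complex ^ 'n" where
  "tensor_apply k A x = (\<chi> i. \<Sum>js | length js = k - 1. A (i # js) * (\<Prod>j\<leftarrow>js. x $ j))"

definition tensor_eigenpair :: "nat \<Rightarrow> 'n::finite tensor \<Rightarrow> complex \<Rightarrow> complex ^ 'n \<Rightarrow> bool" where
  "tensor_eigenpair k A l x \<longleftrightarrow> x \<noteq> 0 \<and> tensor_apply k A x = (\<chi> i. l * (x $ i) ^ (k - 1))"

definition tensor_eigenvalue :: "nat \<Rightarrow> 'n::finite tensor \<Rightarrow> complex \<Rightarrow> bool" where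
  "tensor_eigenvalue k A l \<longleftrightarrow> (\<exists>x. tensor_eigenpair k A l x)"

definition tensor_H_eigenvalue :: "nat \<Rightarrow> 'n::finite tensor \<Rightarrow> complex \<Rightarrow> bool" where
  "tensor_H_eigenvalue k A l \<longleftrightarrow> (\<exists>x. tensor_eigenpair k A l x \<and> (\<forall>i. x $ i \<in> \<real>))"

text \<open>The maximum modulus of the eigenvalues; unspecified if no maximum is attained.\<close>

definition tensor_spectral_radius :: "nat \<Rightarrow> 'n::finite tensor \<Rightarrow> real" where
  "tensor_spectral_radius k A = (GREATEST r. \<exists>l. tensor_eigenvalue k A l \<and> r = cmod l)"

end

theory Submission
  imports Defs "HOL-Combinatorics.Multiset_Permutations"
begin

text \<open>
  Every condition turns out to say that some vertex set \<open>U\<close> satisfies \<open>\<gamma> e * (-1)^\<bar>e \<inter> U\<bar> = -1\<close> on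
  all edges. For (3), \<open>\<rho>\<close> of the unsigned adjacency tensor is the maximum \<open>\<mu>\<close> of the quotient of
  \<open>k * (\<Sum>e\<in>E. \<Prod>v\<in>e. x v)\<close> by \<open>\<Sum>v. x v ^ k\<close> over real \<open>x\<close>: a maximizer is an eigenvector by the Lagrange
  condition, and taking moduli bounds all complex eigenvalues. If \<open>-\<mu>\<close> is an H-eigenvalue of the
  signed tensor with eigenvector \<open>x\<close>, then \<open>\<bar>x\<bar>\<close> is a maximizer, hence has no zero coordinate by
  connectedness, and equality in the triangle inequality forces \<open>\<gamma> e * (\<Prod>v\<in>e. x v) < 0\<close> for every
  edge, so the negative coordinates of \<open>x\<close> form \<open>U\<close>. For (5), the eigenvalue equation at a
  coordinate of maximal modulus forces that modulus on all neighbours, hence everywhere, and the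
  signs of \<open>x\<close> again give \<open>U\<close>.
\<close>

section \<open>Edge form, its gradient, and sign vectors\<close>

text \<open>This is coordinate \<open>i\<close> of the signed adjacency tensor applied to
  \<open>x\<close>, and also the partial derivative of \<open>adj_form\<close> at \<open>i\<close>.
  The ring stays general because complex eigenvectors and real maximizers both occur.\<close>

definition adj_grad :: "'n set set \<Rightarrow> ('n set \<Rightarrow> int) \<Rightarrow> ('n \<Rightarrow> 'a::comm_ring_1) \<Rightarrow> 'n \<Rightarrow> 'a" where
  "adj_grad E \<gamma> x i = (\<Sum>e | e \<in> E \<and> i \<in> e. of_int (\<gamma> e) * (\<Prod>v\<in>e - {i}. x v))"

definition adj_form :: "'n set set \<Rightarrow> ('n set \<Rightarrow> int) \<Rightarrow> ('n \<Rightarrow> 'a::comm_ring_1) \<Rightarrow> 'a" where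
  "adj_form E \<gamma> x = (\<Sum>e\<in>E. of_int (\<gamma> e) * (\<Prod>v\<in>e. x v))"

text \<open>Encoding a sign vector by the set of its negative coordinates turns switchings,
  signature matrices and bipartitions alike into a choice of \<open>U\<close>.\<close>

definition sign_on :: "'n set \<Rightarrow> 'n \<Rightarrow> 'a::comm_ring_1" where
  "sign_on U v = (if v \<in> U then -1 else 1)"

lemma sign_on_sq [simp]: "sign_on U v * sign_on U v = 1"
  by (simp add: sign_on_def)

lemma sign_on_power: "sign_on U v ^ m = (if even m then 1 else sign_on U v)"
  by (auto simp: sign_on_def)

lemma prod_sign_on:
  assumes "finite e"
  shows "(\<Prod>v\<in>e. sign_on U v) = (-1) ^ card (e \<inter> U)"
  using assms by (simp add: sign_on_def prod.If_cases Int_def)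

text \<open>Along an incidence walk from \<open>z\<close>, the invariant is that visited vertices
  lie in \<open>Z\<close> and visited edges are contained in \<open>Z\<close>. It is applied to the
  zero set of a maximizer and to the set of coordinates of maximal modulus.\<close>

lemma connected_hypergraph_closed_UNIV:
  assumes "connected_hypergraph E" and "z \<in> Z"
    and closed: "\<And>e. e \<in> E \<Longrightarrow> e \<inter> Z \<noteq> {} \<Longrightarrow> e \<subseteq> Z"
  shows "Z = UNIV"
proof -
  have "case b of Inl v \<Rightarrow> v \<in> Z | Inr e \<Rightarrow> e \<in> E \<and> e \<subseteq> Z"
    if "(a, b) \<in> (incidence E)\<^sup>*" "a = Inl z" for a b
    using that
  proof induction
    case base
    then show ?case using \<open>z \<in> Z\<close> by simp
  next
    case (step b c)
    then show ?case using closed unfolding incidence_def by fastforce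
  qed
  moreover have "(Inl z, Inl v) \<in> (incidence E)\<^sup>*" for v
    using assms(1) by (auto simp: connected_hypergraph_def)
  ultimately show ?thesis by fastforce
qed

section \<open>Switching sequences as vertex sets\<close>

lemma fold_vertex_switch:
  fixes vs :: "'n::finite list"
  shows "fold vertex_switch vs \<gamma> e = \<gamma> e * (\<Prod>v\<in>e. (-1) ^ count_list vs v)"
proof (induction vs arbitrary: \<gamma>)
  case (Cons a vs)
  have "(\<Prod>v\<in>e. (-1) ^ count_list (a # vs) v)
      = (\<Prod>v\<in>e. (if v = a then -1 else 1) * (-1::int) ^ count_list vs v)"
    by (intro prod.cong) auto
  also have "\<dots> = (if a \<in> e then -1 else 1) * (\<Prod>v\<in>e. (-1) ^ count_list vs v)"
    by (simp add: prod.distrib)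
  finally show ?case
    using Cons.IH[of "vertex_switch a \<gamma>"] by (simp add: vertex_switch_def)
qed simp

text \<open>Only the parity of the number of switches at each vertex matters. A sequence yields the
  set of vertices switched an odd number of times; a set is realized by switching each of its
  vertices once.\<close>

lemma switching_equivalent_iff:
  fixes E :: "'n::finite set set"
  shows "switching_equivalent E \<gamma> \<gamma>' \<longleftrightarrow> (\<exists>U. \<forall>e\<in>E. \<gamma> e * (-1) ^ card (e \<inter> U) = \<gamma>' e)"
proof
  assume "switching_equivalent E \<gamma> \<gamma>'"
  then obtain vs where vs: "\<And>e. e \<in> E \<Longrightarrow> fold vertex_switch vs \<gamma> e = \<gamma>' e"
    by (auto simp: switching_equivalent_def)
  define U where "U = {v. odd (count_list vs v)}"
  have "(-1) ^ count_list vs v = (sign_on U v :: int)" for v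
    by (simp add: U_def sign_on_def)
  then have "\<gamma> e * (-1) ^ card (e \<inter> U) = \<gamma>' e" if "e \<in> E" for e
    using vs[OF that] by (simp add: fold_vertex_switch prod_sign_on)
  then show "\<exists>U. \<forall>e\<in>E. \<gamma> e * (-1) ^ card (e \<inter> U) = \<gamma>' e" by blast
next
  assume "\<exists>U. \<forall>e\<in>E. \<gamma> e * (-1) ^ card (e \<inter> U) = \<gamma>' e"
  then obtain U where U: "\<And>e. e \<in> E \<Longrightarrow> \<gamma> e * (-1) ^ card (e \<inter> U) = \<gamma>' e" by blast
  obtain vs where vs: "set vs = U" "distinct vs"
    using finite_distinct_list[of U] by auto
  have "(-1) ^ count_list vs v = (sign_on U v :: int)" for v
    using vs by (cases "v \<in> U") (auto simp: sign_on_def count_list_0_iff distinct_count_atmost_1 simp flip: count_mset)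
  then have "fold vertex_switch vs \<gamma> e = \<gamma>' e" if "e \<in> E" for e
    using U[OF that] by (simp add: fold_vertex_switch prod_sign_on)
  then show "switching_equivalent E \<gamma> \<gamma>'"
    by (auto simp: switching_equivalent_def)
qed

section \<open>Signature matrices acting on tensors\<close>

lemma signature_matrix_iff:
  "signature_matrix S \<longleftrightarrow> (\<exists>U. S = (\<chi> i j. if i = j then sign_on U i else 0))"
proof
  assume S: "signature_matrix S"
  have "S = (\<chi> i j. if i = j then sign_on {i. S $ i $ i = -1} i else 0)"
    using S by (auto simp: signature_matrix_def sign_on_def vec_eq_iff)
  then show "\<exists>U. S = (\<chi> i j. if i = j then sign_on U i else 0)" by blast
qed (auto simp: signature_matrix_def sign_on_def)

lemma diag_tensor_mult_sign_on:
  assumes "S = (\<chi> i j. if i = j then sign_on U i else 0)" "is \<noteq> []"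
  shows "diag_tensor_mult S A S is = A is * (\<Prod>i\<leftarrow>is. sign_on U i)"
  using assms by (cases "is") (auto simp: diag_tensor_mult_def)

text \<open>At a nonzero entry, \<open>k\<close> indices enumerate an edge of size \<open>k\<close>,
  so they are distinct and the product of signs over the list is the product over the edge.\<close>

lemma diag_tensor_mult_adjacency:
  assumes "S = (\<chi> i j. if i = j then sign_on U i else 0)" "k \<ge> 1" "uniform_hypergraph k E"
  shows "diag_tensor_mult S (adjacency_tensor k E \<gamma>) S
    = adjacency_tensor k E (\<lambda>e. \<gamma> e * (-1) ^ card (e \<inter> U))"
proof
  fix "is"
  show "diag_tensor_mult S (adjacency_tensor k E \<gamma>) S is
    = adjacency_tensor k E (\<lambda>e. \<gamma> e * (-1) ^ card (e \<inter> U)) is"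
  proof (cases "length is = k \<and> set is \<in> E")
    case True
    then have "is \<noteq> []" "distinct is"
      using assms by (auto simp: uniform_hypergraph_def intro: card_distinct)
    then have "(\<Prod>i\<leftarrow>is. sign_on U i :: complex) = (-1) ^ card (set is \<inter> U)"
      by (metis prod.distinct_set_conv_list prod_sign_on List.finite_set)
    then show ?thesis
      using True \<open>is \<noteq> []\<close> by (simp add: diag_tensor_mult_sign_on[OF assms(1)] adjacency_tensor_def)
  next
    case False
    then show ?thesis by (auto simp: diag_tensor_mult_def adjacency_tensor_def)
  qed
qed

text \<open>A diagonal entry picks up the same sign \<open>k\<close> times, which cancels for even
  \<open>k\<close>; only the adjacency part changes.\<close>

lemma diag_tensor_mult_laplacian:
  assumes S: "S = (\<chi> i j. if i = j then sign_on U i else 0)"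
    and k: "k \<ge> 1" "even k" and E: "uniform_hypergraph k E"
  shows "diag_tensor_mult S (laplacian_tensor k E \<gamma>) S
    = laplacian_tensor k E (\<lambda>e. \<gamma> e * (-1) ^ card (e \<inter> U))"
proof
  fix "is" :: "'a list"
  have "diag_tensor_mult S (degree_tensor k E) S is = degree_tensor k E is"
  proof (cases "is = replicate k (hd is)")
    case True
    then have "is \<noteq> []" using k by auto
    have "(\<Prod>i\<leftarrow>is. sign_on U i :: complex) = 1"
      using k by (subst True) (simp add: sign_on_power)
    then show ?thesis by (simp add: diag_tensor_mult_sign_on[OF S \<open>is \<noteq> []\<close>])
  qed (simp add: diag_tensor_mult_def degree_tensor_def)
  moreover have "diag_tensor_mult S (laplacian_tensor k E \<gamma>) S is
    = diag_tensor_mult S (degree_tensor k E) S is + diag_tensor_mult S (adjacency_tensor k E \<gamma>) S is"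
    by (simp add: diag_tensor_mult_def laplacian_tensor_def algebra_simps)
  ultimately show "diag_tensor_mult S (laplacian_tensor k E \<gamma>) S is
    = laplacian_tensor k E (\<lambda>e. \<gamma> e * (-1) ^ card (e \<inter> U)) is"
    by (simp add: diag_tensor_mult_adjacency[OF S k(1) E] laplacian_tensor_def)
qed

lemma adjacency_tensor_eq_iff:
  assumes "uniform_hypergraph k E"
  shows "adjacency_tensor k E \<gamma> = adjacency_tensor k E \<gamma>' \<longleftrightarrow> (\<forall>e\<in>E. \<gamma> e = \<gamma>' e)"
proof
  assume eq: "adjacency_tensor k E \<gamma> = adjacency_tensor k E \<gamma>'"
  show "\<forall>e\<in>E. \<gamma> e = \<gamma>' e"
  proof
    fix e assume "e \<in> E"
    then obtain xs where "set xs = e" "length xs = k"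
      using assms finite_distinct_list[of e] distinct_card
      by (metis uniform_hypergraph_def)
    then show "\<gamma> e = \<gamma>' e"
      using fun_cong[OF eq, of xs] \<open>e \<in> E\<close> by (simp add: adjacency_tensor_def)
  qed
qed (auto simp: adjacency_tensor_def)

section \<open>Applying the tensors to a vector, edge by edge\<close>

text \<open>For an edge \<open>e\<close> through \<open>i\<close>, the contributing index lists are
  the (k-1)! orderings of \<open>e - {i}\<close>, which cancels the normalization of the
  tensor.\<close>

lemma tensor_apply_adjacency:
  fixes E :: "'n::finite set set"
  assumes "uniform_hypergraph k E"
  shows "tensor_apply k (adjacency_tensor k E \<gamma>) x $ i = adj_grad E \<gamma> (($) x) i"
proof -
  let ?L = "{js::'n list. length js = k - 1}"
  let ?P = "\<lambda>e. {js. length js = k - 1 \<and> set (i # js) = e \<and> length (i # js) = k}"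
  have perms: "?P e = permutations_of_set (e - {i})" if "e \<in> E" "i \<in> e" for e
  proof -
    have e: "finite e" "card e = k" using that assms by (auto simp: uniform_hypergraph_def)
    then have "k > 0" using that card_gt_0_iff by blast
    have "js \<in> ?P e \<longleftrightarrow> set js = e - {i} \<and> distinct js" for js
    proof
      assume js: "js \<in> ?P e"
      then have "distinct (i # js)" using e by (intro card_distinct) auto
      then show "set js = e - {i} \<and> distinct js" using js by auto
    next
      assume js: "set js = e - {i} \<and> distinct js"
      then have "length js = k - 1" using e that distinct_card by fastforce
      then show "js \<in> ?P e" using js that \<open>k > 0\<close> by auto
    qed
    then show ?thesis by (auto simp: permutations_of_set_def)
  qed
  have fin: "finite ?L" using finite_lists_length_eq[of "UNIV :: 'n set" "k - 1"] by simp
  \<comment> \<open>Each entry is written as a sum over edges with the indicator that the edge is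
    \<open>set (i # js)\<close>, so that swapping the sums groups the lists by edge.\<close>
  have "tensor_apply k (adjacency_tensor k E \<gamma>) x $ i
     = (\<Sum>js\<in>?L. \<Sum>e | e \<in> E \<and> i \<in> e. if js \<in> ?P e
          then of_int (\<gamma> e) / fact (k - 1) * (\<Prod>j\<leftarrow>js. x $ j) else 0)"
    unfolding tensor_apply_def vec_lambda_beta
  proof (intro sum.cong refl)
    fix js assume js: "js \<in> ?L"
    have "adjacency_tensor k E \<gamma> (i # js) * (\<Prod>j\<leftarrow>js. x $ j)
      = (\<Sum>e | e \<in> E \<and> i \<in> e. if e = set (i # js) then
          adjacency_tensor k E \<gamma> (i # js) * (\<Prod>j\<leftarrow>js. x $ j) else 0)"
      by (subst sum.delta) (auto simp: adjacency_tensor_def)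
    also have "\<dots> = (\<Sum>e | e \<in> E \<and> i \<in> e. if js \<in> ?P e
          then of_int (\<gamma> e) / fact (k - 1) * (\<Prod>j\<leftarrow>js. x $ j) else 0)"
      using js by (intro sum.cong refl) (auto simp: adjacency_tensor_def)
    finally show "adjacency_tensor k E \<gamma> (i # js) * (\<Prod>j\<leftarrow>js. x $ j)
      = (\<Sum>e | e \<in> E \<and> i \<in> e. if js \<in> ?P e
          then of_int (\<gamma> e) / fact (k - 1) * (\<Prod>j\<leftarrow>js. x $ j) else 0)" .
  qed
  also have "\<dots> = (\<Sum>e | e \<in> E \<and> i \<in> e. \<Sum>js\<in>?L. if js \<in> ?P e
          then of_int (\<gamma> e) / fact (k - 1) * (\<Prod>j\<leftarrow>js. x $ j) else 0)"
    by (rule sum.swap)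
  also have "\<dots> = (\<Sum>e | e \<in> E \<and> i \<in> e. \<Sum>js\<in>?P e. of_int (\<gamma> e) / fact (k - 1) * (\<Prod>j\<leftarrow>js. x $ j))"
    by (intro sum.cong refl sum.mono_neutral_cong_right fin) auto
  also have "\<dots> = adj_grad E \<gamma> (($) x) i"
    unfolding adj_grad_def
  proof (intro sum.cong refl)
    fix e assume "e \<in> {e. e \<in> E \<and> i \<in> e}"
    then have e: "e \<in> E" "i \<in> e" "card (e - {i}) = k - 1" "finite e"
      using assms by (auto simp: uniform_hypergraph_def)
    have "(\<Sum>js\<in>?P e. of_int (\<gamma> e) / fact (k - 1) * (\<Prod>j\<leftarrow>js. x $ j))
      = (\<Sum>js\<in>permutations_of_set (e - {i}). of_int (\<gamma> e) / fact (k - 1) * (\<Prod>v\<in>e - {i}. x $ v))"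
      unfolding perms[OF e(1,2)]
      by (intro sum.cong refl)
        (metis permutations_of_setD prod.distinct_set_conv_list)
    also have "\<dots> = of_int (\<gamma> e) * (\<Prod>v\<in>e - {i}. x $ v)"
      using e by (simp add: card_permutations_of_set)
    finally show "(\<Sum>js\<in>?P e. of_int (\<gamma> e) / fact (k - 1) * (\<Prod>j\<leftarrow>js. x $ j))
      = of_int (\<gamma> e) * (\<Prod>v\<in>e - {i}. x $ v)" .
  qed
  finally show ?thesis .
qed

lemma tensor_apply_laplacian:
  fixes E :: "'n::finite set set"
  assumes "uniform_hypergraph k E" "k \<ge> 1"
  shows "tensor_apply k (laplacian_tensor k E \<gamma>) x $ i
    = of_nat (vertex_degree E i) * (x $ i) ^ (k - 1) + adj_grad E \<gamma> (($) x) i"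
proof -
  let ?L = "{js::'n list. length js = k - 1}"
  have fin: "finite ?L" using finite_lists_length_eq[of "UNIV :: 'n set" "k - 1"] by simp
  have k: "replicate k i = i # replicate (k - 1) i"
    using assms(2) by (cases k) auto
  have "tensor_apply k (laplacian_tensor k E \<gamma>) x $ i
    = (\<Sum>js\<in>?L. degree_tensor k E (i # js) * (\<Prod>j\<leftarrow>js. x $ j))
      + tensor_apply k (adjacency_tensor k E \<gamma>) x $ i"
    by (simp add: tensor_apply_def laplacian_tensor_def distrib_right sum.distrib)
  also have "(\<Sum>js\<in>?L. degree_tensor k E (i # js) * (\<Prod>j\<leftarrow>js. x $ j))
    = (\<Sum>js\<in>?L. if js = replicate (k - 1) i
        then of_nat (vertex_degree E i) * (\<Prod>j\<leftarrow>js. x $ j) else 0)"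
    by (intro sum.cong refl) (simp add: degree_tensor_def k)
  also have "\<dots> = of_nat (vertex_degree E i) * (x $ i) ^ (k - 1)"
    using fin by (subst sum.delta) auto
  finally show ?thesis by (simp add: tensor_apply_adjacency[OF assms(1)])
qed

section \<open>Algebra and estimates for the form and its gradient\<close>

lemma adj_grad_of_real:
  "adj_grad E \<gamma> (\<lambda>i. of_real (x i)) i = (of_real (adj_grad E \<gamma> x i) :: 'a::{real_algebra_1,comm_ring_1})"
  by (simp add: adj_grad_def)

text \<open>Euler's identity for a homogeneous form of degree \<open>k\<close>: each edge monomial
  is counted once for each of its \<open>k\<close> vertices.\<close>

lemma sum_mult_adj_grad:
  fixes E :: "'n::finite set set"
  assumes "uniform_hypergraph k E"
  shows "(\<Sum>i\<in>UNIV. x i * adj_grad E \<gamma> x i) = of_nat k * adj_form E \<gamma> x"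
proof -
  have "(\<Sum>i\<in>UNIV. x i * adj_grad E \<gamma> x i)
      = (\<Sum>i\<in>UNIV. \<Sum>e | e \<in> E \<and> i \<in> e. of_int (\<gamma> e) * (\<Prod>v\<in>e. x v))"
    unfolding adj_grad_def sum_distrib_left
    by (intro sum.cong refl) (auto simp: prod.remove[of _ _ x] algebra_simps)
  also have "\<dots> = (\<Sum>e\<in>E. \<Sum>i | i \<in> UNIV \<and> i \<in> e. of_int (\<gamma> e) * (\<Prod>v\<in>e. x v))"
    using sum.swap_restrict[of "UNIV :: 'n set" E "\<lambda>i e. of_int (\<gamma> e) * (\<Prod>v\<in>e. x v)" "\<lambda>i e. i \<in> e"]
    by simp
  also have "\<dots> = (\<Sum>e\<in>E. of_nat k * (of_int (\<gamma> e) * (\<Prod>v\<in>e. x v)))"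
    using assms by (intro sum.cong refl) (simp add: uniform_hypergraph_def)
  finally show ?thesis by (simp add: adj_form_def sum_distrib_left)
qed

text \<open>No monomial contains a variable twice, so the form is affine in each coordinate and the
  expansion is exact.\<close>

lemma adj_form_add_at:
  fixes E :: "'n::finite set set"
  shows "adj_form E \<gamma> (x(i := x i + t)) = adj_form E \<gamma> x + t * adj_grad E \<gamma> x i"
proof -
  have "of_int (\<gamma> e) * (\<Prod>v\<in>e. (x(i := x i + t)) v)
      = of_int (\<gamma> e) * (\<Prod>v\<in>e. x v)
        + (if i \<in> e then t * (of_int (\<gamma> e) * (\<Prod>v\<in>e - {i}. x v)) else 0)" for e
  proof (cases "i \<in> e")
    case True
    have "(\<Prod>v\<in>e - {i}. (x(i := x i + t)) v) = (\<Prod>v\<in>e - {i}. x v)"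
      by (intro prod.cong) auto
    then show ?thesis using True by (simp add: prod.remove[of e i] algebra_simps)
  next
    case False
    then have "(\<Prod>v\<in>e. (x(i := x i + t)) v) = (\<Prod>v\<in>e. x v)"
      by (intro prod.cong) auto
    then show ?thesis using False by simp
  qed
  then show ?thesis
    by (simp add: adj_form_def adj_grad_def sum.distrib sum_distrib_left flip: sum.inter_filter)
qed

lemma adj_grad_sign_on:
  fixes E :: "'n::finite set set" and x :: "'n \<Rightarrow> 'a::comm_ring_1"
  assumes "\<forall>e\<in>E. \<gamma> e * (-1) ^ card (e \<inter> U) = -1"
  shows "adj_grad E \<gamma> (\<lambda>v. sign_on U v * x v) i = - (sign_on U i * adj_grad E (\<lambda>_. 1) x i)"
proof -
  have "of_int (\<gamma> e) * (\<Prod>v\<in>e - {i}. sign_on U v * x v) = - (sign_on U i * (\<Prod>v\<in>e - {i}. x v))"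
    if "e \<in> E" "i \<in> e" for e
  proof -
    \<comment> \<open>Inserting the square of the sign at \<open>i\<close> completes the product to
      all of \<open>e\<close>, where the hypothesis on \<open>U\<close> applies.\<close>
    have "(\<Prod>v\<in>e - {i}. sign_on U v :: 'a) = sign_on U i * (sign_on U i * (\<Prod>v\<in>e - {i}. sign_on U v))"
      by (simp flip: mult.assoc)
    also have "\<dots> = sign_on U i * (\<Prod>v\<in>e. sign_on U v)"
      using that by (simp add: prod.remove[of e i])
    finally have "(\<Prod>v\<in>e - {i}. sign_on U v :: 'a) = sign_on U i * (-1) ^ card (e \<inter> U)"
      by (simp add: prod_sign_on)
    moreover have "of_int (\<gamma> e) * (-1) ^ card (e \<inter> U) = (-1 :: 'a)"
      using arg_cong[of _ _ "of_int :: int \<Rightarrow> 'a", OF assms[rule_format, OF that(1)]] by simp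
    moreover have "of_int (\<gamma> e) * (sign_on U i * (-1) ^ card (e \<inter> U) * (\<Prod>v\<in>e - {i}. x v))
      = of_int (\<gamma> e) * (-1) ^ card (e \<inter> U) * (sign_on U i * (\<Prod>v\<in>e - {i}. x v))"
      by (simp only: ac_simps)
    ultimately show ?thesis
      by (simp add: prod.distrib)
  qed
  then show ?thesis
    unfolding adj_grad_def by (simp add: sum_distrib_left sum_negf)
qed

lemma adj_form_scale:
  assumes "uniform_hypergraph k E"
  shows "adj_form E \<gamma> (\<lambda>v. c * x v) = c ^ k * adj_form E \<gamma> x"
  using assms
  by (auto simp: adj_form_def uniform_hypergraph_def prod.distrib sum_distrib_left intro!: sum.cong)

lemma abs_adj_form_le:
  fixes x :: "'n \<Rightarrow> 'a::linordered_idom"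
  assumes "\<forall>e\<in>E. \<bar>\<gamma> e\<bar> = 1"
  shows "\<bar>adj_form E \<gamma> x\<bar> \<le> adj_form E (\<lambda>_. 1) (\<lambda>v. \<bar>x v\<bar>)"
  unfolding adj_form_def using assms
  by (intro order_trans[OF sum_abs] sum_mono) (simp add: abs_mult abs_prod flip: of_int_abs)

lemma norm_adj_grad_le:
  fixes x :: "'n::finite \<Rightarrow> complex"
  shows "norm (adj_grad E (\<lambda>_. 1) x i) \<le> adj_grad E (\<lambda>_. 1) (\<lambda>v. norm (x v)) i"
  unfolding adj_grad_def by (intro sum_norm_le) (simp add: prod_norm)

section \<open>Variational description of the spectral radius\<close>

lemma sum_even_power_pos:
  fixes x :: "'n::finite \<Rightarrow> 'a::linordered_idom"
  assumes "even k" "x i \<noteq> 0"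
  shows "0 < (\<Sum>v\<in>UNIV. x v ^ k)"
  using assms by (intro sum_pos2[of UNIV i]) (auto simp: zero_less_power_eq zero_le_power_eq)

text \<open>The quotient of form by power sum is continuous on the compact Euclidean unit sphere, as
  even \<open>k\<close> keeps the denominator positive. Both are homogeneous of degree
  \<open>k\<close>, so the maximum there is global.\<close>

lemma adj_form_maximizer:
  fixes E :: "'n::finite set set"
  assumes E: "uniform_hypergraph k E" and k: "k \<ge> 1" "even k"
  obtains \<mu> :: real and x\<^sub>0 i where "0 \<le> \<mu>" "x\<^sub>0 i \<noteq> 0"
    "\<And>x. real k * adj_form E (\<lambda>_. 1) x \<le> \<mu> * (\<Sum>v\<in>UNIV. x v ^ k)"
    "real k * adj_form E (\<lambda>_. 1) x\<^sub>0 = \<mu> * (\<Sum>v\<in>UNIV. x\<^sub>0 v ^ k)"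
proof -
  define N where "N x = (\<Sum>v\<in>UNIV. x v ^ k)" for x :: "'n \<Rightarrow> real"
  define F where "F x = real k * adj_form E (\<lambda>_. 1) x" for x :: "'n \<Rightarrow> real"
  have Npos: "N x > 0" if "x i \<noteq> 0" for x i
    unfolding N_def using k(2) that by (rule sum_even_power_pos)
  have Npos': "N (($) y) > 0" if "y \<in> sphere 0 1" for y
    using that Npos[of "($) y"] by (metis norm_zero mem_sphere_0 vec_eq_iff zero_index zero_neq_one)
  have "continuous_on (sphere 0 1) (\<lambda>y::real^'n. F (($) y) / N (($) y))"
    using Npos' unfolding F_def N_def adj_form_def
    by (intro continuous_intros) (auto simp: less_le)
  then obtain y where y: "y \<in> sphere 0 1"
    and max: "\<And>z. z \<in> sphere 0 1 \<Longrightarrow> F (($) z) / N (($) z) \<le> F (($) y) / N (($) y)"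
    using continuous_attains_sup[of "sphere (0::real^'n) 1" "\<lambda>y. F (($) y) / N (($) y)"]
    by (auto simp: compact_sphere)
  define \<mu> where "\<mu> = F (($) y) / N (($) y)"
  have bound: "F x \<le> \<mu> * N x" for x
  proof (cases "(\<chi> v. x v) = 0")
    case True
    \<comment> \<open>Writing the zero vector as a multiple by 0 lets homogeneity give the value of
      the form.\<close>
    then have "x = (\<lambda>v. 0 * x v)" by (auto simp: vec_eq_iff)
    then have "F x = 0" "N x = 0"
      using k adj_form_scale[OF E, of "\<lambda>_. 1" 0 x] by (auto simp: F_def N_def power_0_left)
    then show ?thesis by simp
  next
    case False
    define c where "c = norm (\<chi> v. x v)"
    have c: "c > 0" using False by (simp add: c_def)
    define u where "u = (\<chi> v. x v / c)"
    have "u = (1 / c) *\<^sub>R (\<chi> v. x v)" by (simp add: u_def vec_eq_iff)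
    then have u: "u \<in> sphere 0 1" using c by (simp add: c_def)
    have x: "x = (\<lambda>v. c * u $ v)" using c by (simp add: u_def)
    have "F (($) u) \<le> \<mu> * N (($) u)"
      using max[OF u] Npos'[OF u] by (simp add: \<mu>_def pos_divide_le_eq)
    then have "c ^ k * F (($) u) \<le> c ^ k * (\<mu> * N (($) u))"
      using c by (intro mult_left_mono) auto
    moreover have "F x = c ^ k * F (($) u)"
      by (subst x) (simp add: F_def adj_form_scale[OF E])
    moreover have "N x = c ^ k * N (($) u)"
      by (subst x) (simp add: N_def power_mult_distrib sum_distrib_left)
    ultimately show ?thesis by (simp add: algebra_simps)
  qed
  \<comment> \<open>The all-ones vector has nonnegative form and positive power sum.\<close>
  have "0 \<le> F (\<lambda>_. 1)" by (simp add: F_def adj_form_def)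
  also have "\<dots> \<le> \<mu> * N (\<lambda>_. 1)" by (rule bound)
  finally have "0 \<le> \<mu>" by (simp add: N_def zero_le_mult_iff)
  moreover obtain i where "y $ i \<noteq> 0"
    using y by (metis norm_zero mem_sphere_0 vec_eq_iff zero_index zero_neq_one)
  moreover have "F (($) y) = \<mu> * N (($) y)"
    using Npos'[OF y] by (simp add: \<mu>_def)
  ultimately show ?thesis
    using that bound by (simp add: F_def N_def)
qed

text \<open>The Lagrange condition: along each coordinate line, the form is affine and touches the
  \<open>\<mu>\<close>-multiple of the power sum from below.\<close>

lemma adj_grad_maximizer:
  fixes E :: "'n::finite set set" and x :: "'n \<Rightarrow> real"
  assumes k: "k \<ge> 1"
    and bound: "\<And>x. real k * adj_form E (\<lambda>_. 1) x \<le> \<mu> * (\<Sum>v\<in>UNIV. x v ^ k)"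
    and eq: "real k * adj_form E (\<lambda>_. 1) x = \<mu> * (\<Sum>v\<in>UNIV. x v ^ k)"
  shows "adj_grad E (\<lambda>_. 1) x i = \<mu> * x i ^ (k - 1)"
proof -
  define h where "h t = real k * (t * adj_grad E (\<lambda>_. 1) x i) - \<mu> * ((x i + t) ^ k - x i ^ k)" for t
  have "h t \<le> 0" for t
  proof -
    have "(\<Sum>v\<in>UNIV. (x(i := x i + t)) v ^ k)
      = (x i + t) ^ k + (\<Sum>v\<in>UNIV - {i}. (x(i := x i + t)) v ^ k)"
      by (subst sum.remove[of _ i]) auto
    also have "(\<Sum>v\<in>UNIV - {i}. (x(i := x i + t)) v ^ k) = (\<Sum>v\<in>UNIV - {i}. x v ^ k)"
      by (intro sum.cong) auto
    also have "\<dots> = (\<Sum>v\<in>UNIV. x v ^ k) - x i ^ k"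
      by (simp add: sum.remove[of UNIV i])
    finally have power_sum: "(\<Sum>v\<in>UNIV. (x(i := x i + t)) v ^ k)
      = (x i + t) ^ k + ((\<Sum>v\<in>UNIV. x v ^ k) - x i ^ k)" .
    show ?thesis
      using bound[of "x(i := x i + t)"] eq unfolding h_def adj_form_add_at power_sum
      by (simp add: algebra_simps)
  qed
  moreover have "h 0 = 0" by (simp add: h_def)
  moreover have "DERIV h 0 :> real k * adj_grad E (\<lambda>_. 1) x i - \<mu> * (real k * x i ^ (k - 1))"
    unfolding h_def by (auto intro!: derivative_eq_intros)
  ultimately have "real k * adj_grad E (\<lambda>_. 1) x i - \<mu> * (real k * x i ^ (k - 1)) = 0"
    by (intro DERIV_local_max[of h _ 0 1]) auto
  then have "real k * (adj_grad E (\<lambda>_. 1) x i - \<mu> * x i ^ (k - 1)) = 0"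
    by (simp add: algebra_simps)
  then show ?thesis using k by simp
qed

text \<open>If the zero set \<open>Z\<close> were nonempty, connectedness would give an edge meeting
  \<open>Z\<close> but not inside it, and a small increase on \<open>Z\<close> would exceed the
  maximum.\<close>

lemma maximizer_pos:
  fixes E :: "'n::finite set set" and x :: "'n \<Rightarrow> real"
  assumes E: "uniform_hypergraph k E" "connected_hypergraph E" and k: "k \<ge> 1"
    and bound: "\<And>x. real k * adj_form E (\<lambda>_. 1) x \<le> \<mu> * (\<Sum>v\<in>UNIV. x v ^ k)"
    and eq: "real k * adj_form E (\<lambda>_. 1) x = \<mu> * (\<Sum>v\<in>UNIV. x v ^ k)"
    and "0 \<le> \<mu>" and nonneg: "\<And>v. 0 \<le> x v" and "x i \<noteq> 0"
  shows "0 < x v"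
proof (rule ccontr)
  define Z where "Z = {v. x v = 0}"
  assume "\<not> 0 < x v"
  then have "v \<in> Z" using nonneg[of v] by (simp add: Z_def)
  moreover have "Z \<noteq> UNIV" using \<open>x i \<noteq> 0\<close> by (auto simp: Z_def)
  ultimately obtain e\<^sub>0 where e\<^sub>0: "e\<^sub>0 \<in> E" "e\<^sub>0 \<inter> Z \<noteq> {}" "\<not> e\<^sub>0 \<subseteq> Z"
    using connected_hypergraph_closed_UNIV[OF E(2)] by metis
  define c where "c = (\<Prod>v\<in>e\<^sub>0 - Z. x v)"
  define m where "m = card (e\<^sub>0 \<inter> Z)"
  have "c > 0" unfolding c_def using nonneg by (intro prod_pos) (auto simp: Z_def less_le)
  have "m < k"
    unfolding m_def using e\<^sub>0 E(1)
    by (metis Int_lower1 inf.absorb_iff1 psubsetI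
        psubset_card_mono uniform_hypergraph_def)
  text \<open>Raising the zero coordinates to \<open>\<epsilon>\<close> gains at least order \<open>\<epsilon>\<^sup>m\<close> in the form, but costs only
    order \<open>\<epsilon>\<^sup>k\<close> in the power sum.\<close>
  have small: "real k * c \<le> \<mu> * real (card Z) * \<epsilon>" if "0 < \<epsilon>" "\<epsilon> \<le> 1" for \<epsilon>
  proof -
    define z where "z v = (if v \<in> Z then \<epsilon> else x v)" for v
    have xz: "0 \<le> x v" "x v \<le> z v" for v using nonneg that by (auto simp: z_def Z_def)
    have prod_z: "(\<Prod>v\<in>e\<^sub>0. z v) = \<epsilon> ^ m * c"
      unfolding z_def m_def c_def by (subst prod.If_cases) (auto simp: Int_def Diff_eq)
    have prod_x: "(\<Prod>v\<in>e\<^sub>0. x v) = 0" using e\<^sub>0(2) by (auto simp: Z_def)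
    have "adj_form E (\<lambda>_. 1) x + \<epsilon> ^ m * c
      = (\<Prod>v\<in>e\<^sub>0. z v) + (\<Sum>e\<in>E - {e\<^sub>0}. \<Prod>v\<in>e. x v)"
      using e\<^sub>0(1) prod_x prod_z by (simp add: adj_form_def sum.remove[of E e\<^sub>0])
    also have "\<dots> \<le> (\<Prod>v\<in>e\<^sub>0. z v) + (\<Sum>e\<in>E - {e\<^sub>0}. \<Prod>v\<in>e. z v)"
      using xz by (intro add_left_mono sum_mono prod_mono) auto
    also have "\<dots> = adj_form E (\<lambda>_. 1) z"
      using e\<^sub>0(1) by (simp add: adj_form_def sum.remove[of E e\<^sub>0])
    finally have "real k * adj_form E (\<lambda>_. 1) x + real k * (\<epsilon> ^ m * c)
      \<le> real k * adj_form E (\<lambda>_. 1) z"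
      using mult_left_mono[of _ _ "real k"] by (simp flip: distrib_left)
    also have "\<dots> \<le> \<mu> * (\<Sum>v\<in>UNIV. z v ^ k)" by (rule bound)
    also have "(\<Sum>v\<in>UNIV. z v ^ k) = (\<Sum>v\<in>UNIV. x v ^ k + (if v \<in> Z then \<epsilon> ^ k else 0))"
      using k by (intro sum.cong) (auto simp: z_def Z_def)
    also have "\<dots> = (\<Sum>v\<in>UNIV. x v ^ k) + real (card Z) * \<epsilon> ^ k"
      by (simp add: sum.distrib sum.If_cases)
    finally have "real k * (\<epsilon> ^ m * c) \<le> \<mu> * (real (card Z) * \<epsilon> ^ k)"
      using eq by (simp add: algebra_simps)
    moreover have "\<epsilon> ^ (k - 1) \<le> \<epsilon> ^ m"
      using \<open>m < k\<close> that by (intro power_decreasing) auto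
    then have "real k * (\<epsilon> ^ (k - 1) * c) \<le> real k * (\<epsilon> ^ m * c)"
      using \<open>c > 0\<close> by (intro mult_left_mono mult_right_mono) auto
    ultimately have "\<epsilon> ^ (k - 1) * (real k * c) \<le> \<epsilon> ^ (k - 1) * (\<mu> * real (card Z) * \<epsilon>)"
      using k by (cases k) (auto simp: algebra_simps)
    then show ?thesis using that by simp
  qed
  have "0 < real k * c" using \<open>c > 0\<close> k by simp
  define d where "d = \<mu> * real (card Z)"
  have "d \<ge> 0" using \<open>0 \<le> \<mu>\<close> by (simp add: d_def)
  \<comment> \<open>This choice makes \<open>d * \<epsilon>\<close> smaller than half of
    \<open>real k * c\<close>, contradicting \<open>small\<close>; the summand 1 keeps the
    denominator nonzero when \<open>d = 0\<close>.\<close>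
  define \<epsilon> where "\<epsilon> = min 1 (real k * c / 2 / (d + 1))"
  have "0 < \<epsilon>" "\<epsilon> \<le> 1" using \<open>0 < real k * c\<close> \<open>d \<ge> 0\<close> by (auto simp: \<epsilon>_def)
  have "\<epsilon> \<le> real k * c / 2 / (d + 1)" by (simp only: \<epsilon>_def min.cobounded2)
  then have "\<epsilon> * (d + 1) \<le> real k * c / 2"
    using \<open>d \<ge> 0\<close> by (subst (asm) pos_le_divide_eq) auto
  moreover have "real k * c \<le> d * \<epsilon>"
    using small[OF \<open>0 < \<epsilon>\<close> \<open>\<epsilon> \<le> 1\<close>] by (simp add: d_def)
  ultimately show False
    using \<open>0 < \<epsilon>\<close> \<open>0 < real k * c\<close> by (simp add: algebra_simps)
qed

text \<open>Taking moduli in the eigenvalue equation, multiplying by \<open>y v\<close> and summing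
  gives, by Euler's identity, a bound by \<open>k\<close> times the form at \<open>y\<close>, to
  which maximality applies.\<close>

lemma tensor_eigenvalue_norm_le:
  fixes E :: "'n::finite set set"
  assumes E: "uniform_hypergraph k E" and k: "k \<ge> 1" "even k"
    and bound: "\<And>x. real k * adj_form E (\<lambda>_. 1) x \<le> \<mu> * (\<Sum>v\<in>UNIV. x v ^ k)"
    and "tensor_eigenvalue k (hypergraph_adjacency_tensor k E) l"
  shows "cmod l \<le> \<mu>"
proof -
  obtain x where "x \<noteq> 0"
    and x: "tensor_apply k (adjacency_tensor k E (\<lambda>_. 1)) x = (\<chi> i. l * (x $ i) ^ (k - 1))"
    using assms(5)
    by (auto simp: tensor_eigenvalue_def tensor_eigenpair_def hypergraph_adjacency_tensor_def)
  define y where "y v = cmod (x $ v)" for v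
  obtain i where "y i \<noteq> 0" using \<open>x \<noteq> 0\<close> by (auto simp: y_def vec_eq_iff)
  have le: "cmod l * y v ^ k \<le> y v * adj_grad E (\<lambda>_. 1) y v" for v
  proof -
    have "cmod l * y v ^ k = y v * cmod (l * (x $ v) ^ (k - 1))"
      using k(1) by (cases k) (simp_all add: y_def norm_mult norm_power)
    also have "l * (x $ v) ^ (k - 1) = adj_grad E (\<lambda>_. 1) (($) x) v"
      using tensor_apply_adjacency[OF E, of "\<lambda>_. 1" x v] by (simp add: x)
    also have "y v * cmod \<dots> \<le> y v * adj_grad E (\<lambda>_. 1) y v"
      using norm_adj_grad_le[of E "($) x" v]
      by (intro mult_left_mono) (auto simp: y_def[abs_def])
    finally show ?thesis .
  qed
  have "cmod l * (\<Sum>v\<in>UNIV. y v ^ k) \<le> (\<Sum>v\<in>UNIV. y v * adj_grad E (\<lambda>_. 1) y v)"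
    unfolding sum_distrib_left by (intro sum_mono le)
  also have "\<dots> \<le> \<mu> * (\<Sum>v\<in>UNIV. y v ^ k)"
    using bound[of y] by (simp add: sum_mult_adj_grad[OF E])
  finally show ?thesis
    using sum_even_power_pos[of k y, OF k(2) \<open>y i \<noteq> 0\<close>] by simp
qed

section \<open>H-eigenvalues as systems of real equations\<close>

lemma tensor_H_eigenvalue_adjacency_iff:
  fixes E :: "'n::finite set set"
  assumes "uniform_hypergraph k E"
  shows "tensor_H_eigenvalue k (adjacency_tensor k E \<gamma>) (of_real l)
    \<longleftrightarrow> (\<exists>x::'n \<Rightarrow> real. (\<exists>i. x i \<noteq> 0) \<and> (\<forall>i. adj_grad E \<gamma> x i = l * x i ^ (k - 1)))"
proof
  assume "tensor_H_eigenvalue k (adjacency_tensor k E \<gamma>) (of_real l)"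
  then obtain z where z: "z \<noteq> 0" "\<And>i. z $ i \<in> \<real>"
    "tensor_apply k (adjacency_tensor k E \<gamma>) z = (\<chi> i. of_real l * (z $ i) ^ (k - 1))"
    by (auto simp: tensor_H_eigenvalue_def tensor_eigenpair_def)
  define x where "x i = Re (z $ i)" for i
  have zx: "($) z = (\<lambda>i. of_real (x i))" using z(2) by (auto simp: x_def fun_eq_iff)
  have "complex_of_real (adj_grad E \<gamma> x i) = of_real (l * x i ^ (k - 1))" for i
    using tensor_apply_adjacency[OF assms, of \<gamma> z i] zx
    by (simp add: z(3) adj_grad_of_real fun_eq_iff)
  then have "adj_grad E \<gamma> x i = l * x i ^ (k - 1)" for i
    by (simp only: of_real_eq_iff)
  moreover have "\<exists>i. x i \<noteq> 0" using z(1) zx by (auto simp: vec_eq_iff fun_eq_iff)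
  ultimately show "\<exists>x::'n \<Rightarrow> real. (\<exists>i. x i \<noteq> 0) \<and> (\<forall>i. adj_grad E \<gamma> x i = l * x i ^ (k - 1))"
    by blast
next
  assume "\<exists>x::'n \<Rightarrow> real. (\<exists>i. x i \<noteq> 0) \<and> (\<forall>i. adj_grad E \<gamma> x i = l * x i ^ (k - 1))"
  then obtain x i where x: "x i \<noteq> 0" "\<And>i. adj_grad E \<gamma> x i = l * x i ^ (k - 1)" by blast
  define z :: "complex^'n" where "z = (\<chi> i. of_real (x i))"
  have "($) z = (\<lambda>i. of_real (x i))" by (auto simp: z_def)
  then have "tensor_apply k (adjacency_tensor k E \<gamma>) z = (\<chi> i. of_real l * (z $ i) ^ (k - 1))"
    by (simp add: vec_eq_iff tensor_apply_adjacency[OF assms] adj_grad_of_real x(2))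
  moreover have "z \<noteq> 0" using x(1) by (auto simp: z_def vec_eq_iff)
  ultimately show "tensor_H_eigenvalue k (adjacency_tensor k E \<gamma>) (of_real l)"
    by (auto simp: tensor_H_eigenvalue_def tensor_eigenpair_def z_def intro!: exI[of _ z])
qed

lemma tensor_H_eigenvalue_laplacian_0_iff:
  fixes E :: "'n::finite set set"
  assumes "uniform_hypergraph k E" "k \<ge> 1"
  shows "tensor_H_eigenvalue k (laplacian_tensor k E \<gamma>) 0
    \<longleftrightarrow> (\<exists>x::'n \<Rightarrow> real. (\<exists>i. x i \<noteq> 0)
          \<and> (\<forall>i. real (vertex_degree E i) * x i ^ (k - 1) + adj_grad E \<gamma> x i = 0))"
proof
  assume "tensor_H_eigenvalue k (laplacian_tensor k E \<gamma>) 0"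
  then obtain z where z: "z \<noteq> 0" "\<And>i. z $ i \<in> \<real>"
    "tensor_apply k (laplacian_tensor k E \<gamma>) z = 0"
    by (auto simp: tensor_H_eigenvalue_def tensor_eigenpair_def zero_vec_def)
  define x where "x i = Re (z $ i)" for i
  have zx: "($) z = (\<lambda>i. of_real (x i))" using z(2) by (auto simp: x_def fun_eq_iff)
  have "complex_of_real (real (vertex_degree E i) * x i ^ (k - 1) + adj_grad E \<gamma> x i) = of_real 0" for i
    using tensor_apply_laplacian[OF assms, of \<gamma> z i] zx
    by (simp add: z(3) adj_grad_of_real fun_eq_iff)
  then have "real (vertex_degree E i) * x i ^ (k - 1) + adj_grad E \<gamma> x i = 0" for i
    by (simp only: of_real_eq_iff)
  moreover have "\<exists>i. x i \<noteq> 0" using z(1) zx by (auto simp: vec_eq_iff fun_eq_iff)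
  ultimately show "\<exists>x::'n \<Rightarrow> real. (\<exists>i. x i \<noteq> 0)
    \<and> (\<forall>i. real (vertex_degree E i) * x i ^ (k - 1) + adj_grad E \<gamma> x i = 0)"
    by blast
next
  assume "\<exists>x::'n \<Rightarrow> real. (\<exists>i. x i \<noteq> 0)
    \<and> (\<forall>i. real (vertex_degree E i) * x i ^ (k - 1) + adj_grad E \<gamma> x i = 0)"
  then obtain x i where x: "x i \<noteq> 0"
    "\<And>i. real (vertex_degree E i) * x i ^ (k - 1) + adj_grad E \<gamma> x i = 0" by blast
  define z :: "complex^'n" where "z = (\<chi> i. of_real (x i))"
  have "($) z = (\<lambda>i. of_real (x i))" by (auto simp: z_def)
  then have apply_z: "tensor_apply k (laplacian_tensor k E \<gamma>) z $ i
    = of_real (real (vertex_degree E i) * x i ^ (k - 1) + adj_grad E \<gamma> x i)" for i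
    by (simp add: tensor_apply_laplacian[OF assms] adj_grad_of_real)
  have "tensor_apply k (laplacian_tensor k E \<gamma>) z = (\<chi> i. 0 * (z $ i) ^ (k - 1))"
    by (simp only: vec_eq_iff apply_z x(2)) simp
  moreover have "z \<noteq> 0" using x(1) by (auto simp: z_def vec_eq_iff)
  ultimately show "tensor_H_eigenvalue k (laplacian_tensor k E \<gamma>) 0"
    by (auto simp: tensor_H_eigenvalue_def tensor_eigenpair_def z_def intro!: exI[of _ z])
qed

text \<open>The Lagrange condition makes \<open>\<mu>\<close> itself an eigenvalue and the moduli
  estimate bounds all others, so the \<open>GREATEST\<close> in the definition is attained.\<close>

lemma tensor_spectral_radius_adjacency:
  fixes E :: "'n::finite set set" and x :: "'n \<Rightarrow> real"
  assumes E: "uniform_hypergraph k E" and k: "k \<ge> 1" "even k"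
    and bound: "\<And>x. real k * adj_form E (\<lambda>_. 1) x \<le> \<mu> * (\<Sum>v\<in>UNIV. x v ^ k)"
    and eq: "real k * adj_form E (\<lambda>_. 1) x = \<mu> * (\<Sum>v\<in>UNIV. x v ^ k)"
    and "0 \<le> \<mu>" "x i \<noteq> 0"
  shows "tensor_spectral_radius k (hypergraph_adjacency_tensor k E) = \<mu>"
  unfolding tensor_spectral_radius_def
proof (rule Greatest_equality)
  have "tensor_H_eigenvalue k (hypergraph_adjacency_tensor k E) (of_real \<mu>)"
    unfolding hypergraph_adjacency_tensor_def tensor_H_eigenvalue_adjacency_iff[OF E]
    using adj_grad_maximizer[OF k(1) bound eq] \<open>x i \<noteq> 0\<close> by blast
  then show "\<exists>l. tensor_eigenvalue k (hypergraph_adjacency_tensor k E) l \<and> \<mu> = cmod l"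
    using \<open>0 \<le> \<mu>\<close>
    by (intro exI[of _ "of_real \<mu>"]) (auto simp: tensor_H_eigenvalue_def tensor_eigenvalue_def)
next
  fix r
  assume "\<exists>l. tensor_eigenvalue k (hypergraph_adjacency_tensor k E) l \<and> r = cmod l"
  then obtain l where l: "tensor_eigenvalue k (hypergraph_adjacency_tensor k E) l" and r: "r = cmod l"
    by blast
  show "r \<le> \<mu>" unfolding r by (rule tensor_eigenvalue_norm_le[OF E k bound l])
qed

section \<open>Conditions (3) and (5): from eigenvectors to sign sets\<close>

text \<open>Common last step for (3) and (5): split \<open>x v\<close> into sign and modulus, then
  cancel the nonzero product of moduli.\<close>

lemma switching_set_of_signs:
  fixes x :: "'n::finite \<Rightarrow> real"
  assumes "\<And>v. x v \<noteq> 0"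
    and "\<And>e. e \<in> E \<Longrightarrow> of_int (\<gamma> e) * (\<Prod>v\<in>e. x v) = - (\<Prod>v\<in>e. \<bar>x v\<bar>)"
  shows "\<forall>e\<in>E. \<gamma> e * (-1) ^ card (e \<inter> {v. x v < 0}) = -1"
proof
  fix e assume "e \<in> E"
  have "x v = sign_on {v. x v < 0} v * \<bar>x v\<bar>" for v by (simp add: sign_on_def)
  then have "(\<Prod>v\<in>e. x v) = (\<Prod>v\<in>e. sign_on {v. x v < 0} v * \<bar>x v\<bar>)"
    by (intro prod.cong refl)
  also have "\<dots> = (-1) ^ card (e \<inter> {v. x v < 0}) * (\<Prod>v\<in>e. \<bar>x v\<bar>)"
    by (simp only: prod.distrib prod_sign_on[OF finite])
  finally have "of_int (\<gamma> e) * (-1) ^ card (e \<inter> {v. x v < 0}) * (\<Prod>v\<in>e. \<bar>x v\<bar>) = -1 * (\<Prod>v\<in>e. \<bar>x v\<bar>)"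
    using assms(2)[OF \<open>e \<in> E\<close>] by simp
  moreover have "(\<Prod>v\<in>e. \<bar>x v\<bar>) \<noteq> 0" using assms(1) by simp
  ultimately have "of_int (\<gamma> e) * (-1) ^ card (e \<inter> {v. x v < 0}) = (-1 :: real)"
    by (simp only: mult_cancel_right simp_thms)
  then have "real_of_int (\<gamma> e * (-1) ^ card (e \<inter> {v. x v < 0})) = of_int (-1)"
    by simp
  then show "\<gamma> e * (-1) ^ card (e \<inter> {v. x v < 0}) = -1" by (simp only: of_int_eq_iff)
qed

lemma H_eigenvalue_neg_spectral_radius_iff:
  fixes E :: "'n::finite set set"
  assumes E: "uniform_hypergraph k E" "connected_hypergraph E" and k: "k \<ge> 1" "even k"
    and \<gamma>: "\<forall>e\<in>E. \<bar>\<gamma> e\<bar> = 1"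
  shows "tensor_H_eigenvalue k (adjacency_tensor k E \<gamma>)
      (- complex_of_real (tensor_spectral_radius k (hypergraph_adjacency_tensor k E)))
    \<longleftrightarrow> (\<exists>U. \<forall>e\<in>E. \<gamma> e * (-1) ^ card (e \<inter> U) = -1)" (is "?L \<longleftrightarrow> ?R")
proof -
  obtain \<mu> :: real and x\<^sub>0 i\<^sub>0 where \<mu>: "0 \<le> \<mu>" "x\<^sub>0 i\<^sub>0 \<noteq> 0"
    and bound: "\<And>x. real k * adj_form E (\<lambda>_. 1) x \<le> \<mu> * (\<Sum>v\<in>UNIV. x v ^ k)"
    and eq: "real k * adj_form E (\<lambda>_. 1) x\<^sub>0 = \<mu> * (\<Sum>v\<in>UNIV. x\<^sub>0 v ^ k)"
    using adj_form_maximizer[OF E(1) k] by blast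
  have L: "?L \<longleftrightarrow> (\<exists>x::'n \<Rightarrow> real. (\<exists>i. x i \<noteq> 0) \<and> (\<forall>i. adj_grad E \<gamma> x i = - \<mu> * x i ^ (k - 1)))"
    using tensor_H_eigenvalue_adjacency_iff[OF E(1), of \<gamma> "- \<mu>"]
      tensor_spectral_radius_adjacency[OF E(1) k bound eq \<mu>] by simp
  show ?thesis
  proof
    assume ?L
    then obtain x i where x: "x i \<noteq> 0" "\<And>i. adj_grad E \<gamma> x i = - \<mu> * x i ^ (k - 1)"
      unfolding L by blast
    define y where "y v = \<bar>x v\<bar>" for v
    \<comment> \<open>Euler's identity evaluates the signed form at the eigenvector.\<close>
    have "real k * adj_form E \<gamma> x = (\<Sum>v\<in>UNIV. x v * (- \<mu> * x v ^ (k - 1)))"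
      by (simp add: x(2) flip: sum_mult_adj_grad[OF E(1)])
    also have "\<dots> = - \<mu> * (\<Sum>v\<in>UNIV. x v ^ k)"
      unfolding sum_distrib_left using k(1) by (intro sum.cong; cases k) auto
    also have "(\<Sum>v\<in>UNIV. x v ^ k) = (\<Sum>v\<in>UNIV. y v ^ k)"
      using k(2) by (simp add: y_def power_even_abs)
    finally have form_x: "real k * adj_form E \<gamma> x = - \<mu> * (\<Sum>v\<in>UNIV. y v ^ k)" .
    have "- adj_form E \<gamma> x \<le> adj_form E (\<lambda>_. 1) y"
      using abs_adj_form_le[OF \<gamma>, of x] by (simp add: y_def[abs_def] abs_le_iff)
    then have "real k * - adj_form E \<gamma> x \<le> real k * adj_form E (\<lambda>_. 1) y"
      by (intro mult_left_mono) auto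
    \<comment> \<open>The form at \<open>y\<close> is squeezed between its maximal possible value
      and the value forced by \<open>x\<close>, so \<open>y\<close> is a maximizer.\<close>
    with form_x bound[of y] have eq_y: "real k * adj_form E (\<lambda>_. 1) y = \<mu> * (\<Sum>v\<in>UNIV. y v ^ k)"
      by simp
    have "0 < y v" for v
      using x(1) by (intro maximizer_pos[OF E k(1) bound eq_y \<mu>(1), of i]) (auto simp: y_def)
    then have nz: "x v \<noteq> 0" for v by (simp add: y_def)
    have "real k * (adj_form E \<gamma> x + adj_form E (\<lambda>_. 1) y) = 0"
      using form_x eq_y by (simp add: distrib_left)
    then have "adj_form E \<gamma> x + adj_form E (\<lambda>_. 1) y = 0" using k(1) by simp
    \<comment> \<open>Equality in the triangle inequality: nonnegative edge terms with sum 0 all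
      vanish.\<close>
    then have sum0: "(\<Sum>e\<in>E. of_int (\<gamma> e) * (\<Prod>v\<in>e. x v) + (\<Prod>v\<in>e. \<bar>x v\<bar>)) = 0"
      by (simp add: adj_form_def y_def sum.distrib)
    have nonneg: "0 \<le> of_int (\<gamma> e) * (\<Prod>v\<in>e. x v) + (\<Prod>v\<in>e. \<bar>x v\<bar>)" if "e \<in> E" for e
    proof -
      have "\<bar>of_int (\<gamma> e) * (\<Prod>v\<in>e. x v)\<bar> = (\<Prod>v\<in>e. \<bar>x v\<bar>)"
        using \<gamma> that by (simp add: abs_mult abs_prod flip: of_int_abs)
      then show ?thesis by linarith
    qed
    have neg: "of_int (\<gamma> e) * (\<Prod>v\<in>e. x v) = - (\<Prod>v\<in>e. \<bar>x v\<bar>)" if "e \<in> E" for e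
      using sum_nonneg_0[OF finite nonneg sum0 that] by linarith
    show ?R by (rule exI, rule switching_set_of_signs[OF nz neg])
  next
    assume ?R
    then obtain U where U: "\<forall>e\<in>E. \<gamma> e * (-1) ^ card (e \<inter> U) = -1" by blast
    \<comment> \<open>Flipping the maximizer on \<open>U\<close> negates the eigenvalue; since
      \<open>k - 1\<close> is odd, the sign survives in the power.\<close>
    define x where "x v = sign_on U v * x\<^sub>0 v" for v
    have "adj_grad E \<gamma> x i = - \<mu> * x i ^ (k - 1)" for i
      using adj_grad_sign_on[OF U, of x\<^sub>0 i] adj_grad_maximizer[OF k(1) bound eq, of i] k
      by (simp add: x_def[abs_def] power_mult_distrib sign_on_power)
    moreover have "x i\<^sub>0 \<noteq> 0" using \<mu>(2) by (simp add: x_def sign_on_def)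
    ultimately show ?L unfolding L by blast
  qed
qed

lemma H_eigenvalue_laplacian_0_iff:
  fixes E :: "'n::finite set set"
  assumes E: "uniform_hypergraph k E" "connected_hypergraph E" and k: "k \<ge> 1" "even k"
    and \<gamma>: "\<forall>e\<in>E. \<bar>\<gamma> e\<bar> = 1"
  shows "tensor_H_eigenvalue k (laplacian_tensor k E \<gamma>) 0
    \<longleftrightarrow> (\<exists>U. \<forall>e\<in>E. \<gamma> e * (-1) ^ card (e \<inter> U) = -1)" (is "?L \<longleftrightarrow> ?R")
proof
  assume ?L
  then obtain x :: "'n \<Rightarrow> real" and i\<^sub>0 where "x i\<^sub>0 \<noteq> 0"
    and x: "\<And>i. real (vertex_degree E i) * x i ^ (k - 1) + adj_grad E \<gamma> x i = 0"
    unfolding tensor_H_eigenvalue_laplacian_0_iff[OF E(1) k(1)] by blast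
  define M where "M = Max (range (\<lambda>v. \<bar>x v\<bar>))"
  have le_M: "\<bar>x v\<bar> \<le> M" for v unfolding M_def by (intro Max_ge) auto
  have "M > 0" using le_M[of i\<^sub>0] \<open>x i\<^sub>0 \<noteq> 0\<close> by linarith
  have prod_le: "(\<Prod>v\<in>e. \<bar>x v\<bar>) \<le> M ^ k" if "e \<in> E" for e
    using prod_mono[of e "\<lambda>v. \<bar>x v\<bar>" "\<lambda>_. M"] le_M that E(1) by (simp add: uniform_hypergraph_def)
  text \<open>At a coordinate of maximal modulus, \<open>x i\<close> times the eigenvalue equation is a vanishing sum
    of nonnegative terms.\<close>
  have tight: "of_int (\<gamma> e) * (\<Prod>v\<in>e. x v) = - (M ^ k)" if "e \<in> E" "i \<in> e" "\<bar>x i\<bar> = M" for e i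
  proof -
    let ?t = "\<lambda>e. M ^ k + of_int (\<gamma> e) * (\<Prod>v\<in>e. x v)"
    have "(\<Sum>e | e \<in> E \<and> i \<in> e. ?t e)
      = real (vertex_degree E i) * x i ^ k + x i * adj_grad E \<gamma> x i"
    proof -
      have "x i ^ k = M ^ k" using that k(2) by (metis power_even_abs)
      moreover have "(\<Sum>e | e \<in> E \<and> i \<in> e. of_int (\<gamma> e) * (\<Prod>v\<in>e. x v)) = x i * adj_grad E \<gamma> x i"
        unfolding adj_grad_def sum_distrib_left
        by (intro sum.cong refl) (auto simp: prod.remove[of _ i x] algebra_simps)
      ultimately show ?thesis by (simp add: sum.distrib vertex_degree_def)
    qed
    also have "\<dots> = x i * (real (vertex_degree E i) * x i ^ (k - 1) + adj_grad E \<gamma> x i)"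
      using k(1) by (cases k) (simp_all add: algebra_simps)
    finally have sum0: "(\<Sum>e | e \<in> E \<and> i \<in> e. ?t e) = 0" by (simp only: x mult_zero_right)
    have nonneg: "0 \<le> ?t e" if "e \<in> {e. e \<in> E \<and> i \<in> e}" for e
    proof -
      have "\<bar>of_int (\<gamma> e) * (\<Prod>v\<in>e. x v)\<bar> = (\<Prod>v\<in>e. \<bar>x v\<bar>)"
        using \<gamma> that by (simp add: abs_mult abs_prod flip: of_int_abs)
      then show ?thesis using prod_le[of e] that by simp
    qed
    show ?thesis
      using sum_nonneg_0[OF finite nonneg sum0] that by force
  qed
  define Z where "Z = {v. \<bar>x v\<bar> = M}"
  have "M \<in> range (\<lambda>v. \<bar>x v\<bar>)" unfolding M_def by (intro Max_in) auto
  then obtain z where "z \<in> Z" by (auto simp: Z_def)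
  \<comment> \<open>On a tight edge the product of moduli equals \<open>M ^ k\<close> while every
    factor is at most \<open>M\<close>, so no factor can be smaller.\<close>
  moreover have "e \<subseteq> Z" if e: "e \<in> E" "e \<inter> Z \<noteq> {}" for e
  proof
    fix v assume "v \<in> e"
    obtain i where "i \<in> e" "\<bar>x i\<bar> = M" using e by (auto simp: Z_def)
    then have "\<bar>of_int (\<gamma> e) * (\<Prod>v\<in>e. x v)\<bar> = M ^ k"
      using tight e \<open>M > 0\<close> by simp
    then have "M ^ k = (\<Prod>v\<in>e. \<bar>x v\<bar>)"
      using \<gamma> e by (simp add: abs_mult abs_prod flip: of_int_abs)
    also have "\<dots> = \<bar>x v\<bar> * (\<Prod>v\<in>e - {v}. \<bar>x v\<bar>)"
      using \<open>v \<in> e\<close> by (simp add: prod.remove)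
    also have "\<dots> \<le> \<bar>x v\<bar> * M ^ (k - 1)"
      using prod_mono[of "e - {v}" "\<lambda>v. \<bar>x v\<bar>" "\<lambda>_. M"] le_M \<open>v \<in> e\<close> e(1) E(1)
      by (intro mult_left_mono) (auto simp: uniform_hypergraph_def)
    finally have "M * M ^ (k - 1) \<le> \<bar>x v\<bar> * M ^ (k - 1)"
      using k(1) by (cases k) simp_all
    then have "M \<le> \<bar>x v\<bar>" using \<open>M > 0\<close> by simp
    then show "v \<in> Z" using le_M[of v] by (simp add: Z_def)
  qed
  ultimately have "Z = UNIV" by (rule connected_hypergraph_closed_UNIV[OF E(2)])
  then have abs_x: "\<bar>x v\<bar> = M" for v by (auto simp: Z_def)
  have neg: "of_int (\<gamma> e) * (\<Prod>v\<in>e. x v) = - (\<Prod>v\<in>e. \<bar>x v\<bar>)" if "e \<in> E" for e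
  proof -
    have "card e = k" using E(1) that by (simp add: uniform_hypergraph_def)
    then obtain i where "i \<in> e" using k(1) by fastforce
    then show ?thesis using tight[OF that _ abs_x] \<open>card e = k\<close> by (simp add: abs_x)
  qed
  have nz: "x v \<noteq> 0" for v using abs_x[of v] \<open>M > 0\<close> by auto
  show ?R by (rule exI, rule switching_set_of_signs[OF nz neg])
next
  assume ?R
  then obtain U where U: "\<forall>e\<in>E. \<gamma> e * (-1) ^ card (e \<inter> U) = -1" by blast
  \<comment> \<open>The unsigned Laplacian annihilates the all-ones vector, so the sign vector of
    \<open>U\<close> is a null vector of the signed one.\<close>
  have "adj_grad E (\<lambda>_. 1) (\<lambda>_. 1) i = real (vertex_degree E i)" for i
    by (simp add: adj_grad_def vertex_degree_def)
  then have "real (vertex_degree E i) * sign_on U i ^ (k - 1) + adj_grad E \<gamma> (sign_on U) i = 0" for i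
    using adj_grad_sign_on[OF U, of "\<lambda>_. 1 :: real" i] k by (simp add: sign_on_power)
  moreover have "sign_on U i \<noteq> (0::real)" for i by (simp add: sign_on_def)
  ultimately show ?L
    unfolding tensor_H_eigenvalue_laplacian_0_iff[OF E(1) k(1)] by blast
qed

section \<open>Reduction of the six conditions to a single sign equation\<close>

theorem theorem4p10:
  fixes E :: "'n::finite set set"
    and \<sigma> :: "'n set \<Rightarrow> 'n \<Rightarrow> int"
    and k :: nat
  assumes "k \<ge> 2" and "even k"
    and "uniform_hypergraph k E"
    and "connected_hypergraph E"
    and "orientation E \<sigma>"
  shows "let \<gamma> = induced_sign \<sigma>;
             P1 = switching_equivalent E \<gamma> (induced_sign (\<lambda>_ _. 1));
             P2 = (\<exists>S. signature_matrix S \<and>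
                    diag_tensor_mult S (adjacency_tensor k E \<gamma>) S
                      = (\<lambda>is. - hypergraph_adjacency_tensor k E is));
             P3 = tensor_H_eigenvalue k (adjacency_tensor k E \<gamma>)
                    (- complex_of_real (tensor_spectral_radius k (hypergraph_adjacency_tensor k E)));
             P4 = (\<exists>S. signature_matrix S \<and>
                    diag_tensor_mult S (laplacian_tensor k E \<gamma>) S = hypergraph_laplacian_tensor k E);
             P5 = tensor_H_eigenvalue k (laplacian_tensor k E \<gamma>) 0;
             P6 = (\<exists>Vp Vm. Vp \<union> Vm = UNIV \<and> Vp \<inter> Vm = {} \<and>
                    (\<forall>e\<in>E. (\<gamma> e = 1 \<longrightarrow> odd (card (e \<inter> Vm))) \<and>
                           (\<gamma> e = -1 \<longrightarrow> even (card (e \<inter> Vm)))))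
         in (P1 \<longleftrightarrow> P2) \<and> (P1 \<longleftrightarrow> P3) \<and> (P1 \<longleftrightarrow> P4) \<and> (P1 \<longleftrightarrow> P5) \<and> (P1 \<longleftrightarrow> P6)"
proof -
  note k = assms(1,2) and E = assms(3,4)
  have k1: "k \<ge> 1" using k by simp
  define \<gamma> where "\<gamma> = induced_sign \<sigma>"
  define R where "R \<longleftrightarrow> (\<exists>U. \<forall>e\<in>E. \<gamma> e * (-1) ^ card (e \<inter> U) = -1)"
  have \<gamma>: "\<forall>e\<in>E. \<bar>\<gamma> e\<bar> = 1"
  proof
    fix e assume "e \<in> E"
    then have "(\<Prod>v\<in>e. \<bar>\<sigma> e v\<bar>) = 1"
      using assms(5) by (intro prod.neutral) (fastforce simp: orientation_def)
    then show "\<bar>\<gamma> e\<bar> = 1"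
      by (simp add: \<gamma>_def induced_sign_def abs_mult abs_prod)
  qed
  \<comment> \<open>Since \<open>k\<close> is even, \<open>k - 1\<close> is odd: the all-positive
    orientation makes every edge negative, the source of the value -1 in \<open>R\<close>.\<close>
  have plus: "induced_sign (\<lambda>_ _. 1) e = -1" if "e \<in> E" for e
    using that E(1) k by (simp add: induced_sign_def uniform_hypergraph_def)
  have 1: "switching_equivalent E \<gamma> (induced_sign (\<lambda>_ _. 1)) \<longleftrightarrow> R"
    by (simp add: switching_equivalent_iff R_def plus)
  have signature: "(\<exists>S. signature_matrix S \<and> Q S)
      \<longleftrightarrow> (\<exists>U. Q (\<chi> i j. if i = j then sign_on U i else 0))" for Q :: "complex^'n^'n \<Rightarrow> bool"
    by (auto simp: signature_matrix_iff)
  \<comment> \<open>Both target tensors are signed tensors with constant sign -1, so (2) and (4)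
    become comparisons of edge signs.\<close>
  have "(\<lambda>is. - hypergraph_adjacency_tensor k E is) = adjacency_tensor k E (\<lambda>_. -1)"
    by (auto simp: hypergraph_adjacency_tensor_def adjacency_tensor_def)
  then have 2: "(\<exists>S. signature_matrix S \<and> diag_tensor_mult S (adjacency_tensor k E \<gamma>) S
      = (\<lambda>is. - hypergraph_adjacency_tensor k E is)) \<longleftrightarrow> R"
    unfolding signature
    by (simp add: diag_tensor_mult_adjacency[OF refl k1 E(1)] adjacency_tensor_eq_iff[OF E(1)] R_def)
  have "laplacian_tensor k E \<gamma>' = hypergraph_laplacian_tensor k E \<longleftrightarrow> (\<forall>e\<in>E. \<gamma>' e = -1)" for \<gamma>'
  proof -
    have "hypergraph_laplacian_tensor k E = laplacian_tensor k E (\<lambda>_. -1)"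
      by (auto simp: hypergraph_laplacian_tensor_def laplacian_tensor_def
          hypergraph_adjacency_tensor_def adjacency_tensor_def)
    then show ?thesis
      by (simp add: fun_eq_iff laplacian_tensor_def flip: adjacency_tensor_eq_iff[OF E(1)])
  qed
  then have 4: "(\<exists>S. signature_matrix S \<and> diag_tensor_mult S (laplacian_tensor k E \<gamma>) S
      = hypergraph_laplacian_tensor k E) \<longleftrightarrow> R"
    unfolding signature by (simp add: diag_tensor_mult_laplacian[OF refl k1 k(2) E(1)] R_def)
  have iff: "\<gamma> e * (-1) ^ card (e \<inter> U) = -1
      \<longleftrightarrow> (\<gamma> e = 1 \<longrightarrow> odd (card (e \<inter> U))) \<and> (\<gamma> e = -1 \<longrightarrow> even (card (e \<inter> U)))"
    if "e \<in> E" for e U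
  proof -
    have "\<gamma> e = 1 \<or> \<gamma> e = -1" using \<gamma> that by fastforce
    then show ?thesis by (cases "even (card (e \<inter> U))") auto
  qed
  have 6: "(\<exists>Vp Vm. Vp \<union> Vm = UNIV \<and> Vp \<inter> Vm = {} \<and>
      (\<forall>e\<in>E. (\<gamma> e = 1 \<longrightarrow> odd (card (e \<inter> Vm))) \<and> (\<gamma> e = -1 \<longrightarrow> even (card (e \<inter> Vm))))) \<longleftrightarrow> R"
    (is "?B \<longleftrightarrow> R")
  proof
    assume R
    then obtain U where "\<forall>e\<in>E. \<gamma> e * (-1) ^ card (e \<inter> U) = -1" by (auto simp: R_def)
    \<comment> \<open>The set \<open>U\<close> serves as the part \<open>Vm\<close>, its complement
      as \<open>Vp\<close>.\<close>
    then show ?B using iff by (intro exI[of _ "- U"] exI[of _ U]) auto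
  qed (use iff in \<open>auto simp: R_def\<close>)
  show ?thesis
    unfolding Let_def \<gamma>_def[symmetric]
    using 1 2 4 6 H_eigenvalue_neg_spectral_radius_iff[OF E k1 k(2) \<gamma>]
      H_eigenvalue_laplacian_0_iff[OF E k1 k(2) \<gamma>]
    by (simp add: R_def)
qed

end
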